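(* Let $\mathbb{F}$ be $\mathbb{R}$ or $\mathbb{C}$. Let $G$ be a finite group, $\rho: G \to \mathrm{GL}_{n_3}(\mathbb{F})$ a representation, and $M \in \mathrm{GL}_{n_3}(\mathbb{F})$. Then the multiplication map $T_{\mathbf{a}}: \mathbb{F}_M \to \mathbb{F}_M$ is $\rho$-equivariant for all $\mathbf{a} \in \mathbb{F}_M$ if and only if $M\rho(g)M^{-1}$ is diagonal for each $g \in G$.
   Context: A tube is an element $\mathbf{a} \in \mathbb{F}^{1\times 1\times n_3}$; $\mathrm{vec}(\mathbf{a}) \in \mathbb{F}^{n_3}$ is the column vector with entries $\mathrm{vec}(\mathbf{a})_k = \mathbf{a}_{1,1,k}$, and $\mathrm{tube}$ is the inverse of $\mathrm{vec}$. For a vector $v$, $\mathrm{diag}(v)$ is the diagonal matrix with the entries of $v$ on the diagonal. For $M \in \mathrm{GL}_{n_3}(\mathbb{F})$, the $\star_M$-product of tubes is $\mathbf{a} \star_M \mathbf{b} = \mathrm{tube}(M^{-1}\mathrm{diag}(M\mathrm{vec}(\mathbf{a}))M\mathrm{vec}(\mathbf{b}))$, and $\mathbb{F}_M$ denotes the ring of tubes $\mathbb{F}^{1\times1\times n_3}$ with multiplication $\star_M$. The multiplication map is $T_{\mathbf{a}}(\mathbf{x}) = \mathbf{a} \star_M \mathbf{x}$. The group $G$ acts on tubes by $g\cdot \mathbf{x} = \mathrm{tube}(\rho(g)\mathrm{vec}(\mathbf{x}))$, and $T_{\mathbf{a}}$ is $\rho$-equivariant if $T_{\mathbf{a}}(g\cdot\mathbf{x})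 = g\cdot T_{\mathbf{a}}(\mathbf{x})$ for all $g \in G$ and all tubes $\mathbf{x}$. *)

theory Defs
  imports "HOL-Analysis.Analysis" "HOL-Algebra.Algebra"
begin

definition GL :: "('f::field ^ 'n ^ 'n) monoid" where
  "GL = \<lparr>carrier = {A. invertible A}, monoid.mult = (**), monoid.one = mat 1\<rparr>"

lemma GL_group: "group (GL :: ('f::field ^ 'n ^ 'n) monoid)"
proof (rule groupI)
  fix A :: "'f ^ 'n ^ 'n" assume "A \<in> carrier GL"
  then obtain B where "A ** B = mat 1" "B ** A = mat 1"
    by (auto simp: GL_def invertible_def)
  then show "\<exists>B \<in> carrier GL. B \<otimes>\<^bsub>GL\<^esub> A = \<one>\<^bsub>GL\<^esub>"
    by (auto simp: GL_def invertible_def)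
next
  show "\<one>\<^bsub>GL\<^esub> \<in> carrier (GL :: ('f ^ 'n ^ 'n) monoid)"
    unfolding GL_def invertible_def by (auto intro: exI[of _ "mat 1"])
qed (auto simp: GL_def invertible_mult matrix_mul_assoc)

text \<open>A tube is a \<open>1 \<times> 1 \<times> n\<^sub>3\<close> array; its entry at position \<open>(1, 1, k)\<close> is \<open>a $ 1 $ 1 $ k\<close>,
  and \<open>n\<^sub>3\<close> is the cardinality of the index type.\<close>

type_synonym ('f, 'n) tube = "'f ^ 'n ^ 1 ^ 1"

definition tvec :: "('f, 'n) tube \<Rightarrow> 'f ^ 'n" where
  "tvec a = (\<chi> k. a $ 1 $ 1 $ k)"

definition tube :: "'f ^ 'n \<Rightarrow> ('f, 'n) tube" where
  "tube v = (\<chi> i j k. v $ k)"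

lemma tvec_tube [simp]: "tvec (tube v) = v"
  by (simp add: tvec_def tube_def vec_eq_iff)

lemma tube_tvec [simp]: "tube (tvec a) = a"
  by (simp add: tvec_def tube_def vec_eq_iff forall_1)

definition diag :: "'f::zero ^ 'n \<Rightarrow> 'f ^ 'n ^ 'n" where
  "diag v = (\<chi> i j. if i = j then v $ i else 0)"

definition is_diagonal :: "'f::zero ^ 'n ^ 'n \<Rightarrow> bool" where
  "is_diagonal A \<longleftrightarrow> (\<forall>i j. i \<noteq> j \<longrightarrow> A $ i $ j = 0)"

definition tube_prod ::
  "'f::field ^ 'n ^ 'n \<Rightarrow> ('f, 'n) tube \<Rightarrow> ('f, 'n) tube \<Rightarrow> ('f, 'n) tube" where
  "tube_prod M a b = tube ((matrix_inv M ** diag (M *v tvec a) ** M) *v tvec b)"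

text \<open>The unit is the tube whose image under \<open>M\<close> is the all-ones vector.\<close>

definition tube_ring :: "'f::field ^ 'n ^ 'n \<Rightarrow> ('f, 'n) tube ring" where
  "tube_ring M = \<lparr>carrier = UNIV, monoid.mult = tube_prod M,
     monoid.one = tube (matrix_inv M *v (\<chi> k. 1)), ring.zero = 0, ring.add = (+)\<rparr>"

lemma tvec_add: "tvec (a + b) = tvec a + tvec (b :: ('f::field, 'n::finite) tube)"
  by (simp add: tvec_def vec_eq_iff)

lemma diag_mult_vec: "diag u *v v = (\<chi> k. u $ k * (v $ k :: 'f::field))"
  by (simp add: diag_def matrix_vector_mult_def vec_eq_iff if_distrib if_distribR cong: if_cong)

lemma matrix_inv_mul:
  assumes "invertible (M :: 'f::field ^ 'n ^ 'n)"
  shows "M ** matrix_inv M = mat 1" "matrix_inv M ** M = mat 1"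
proof -
  have "M ** matrix_inv M = mat 1 \<and> matrix_inv M ** M = mat 1"
    using assms unfolding invertible_def matrix_inv_def by (rule someI_ex)
  then show "M ** matrix_inv M = mat 1" "matrix_inv M ** M = mat 1" by auto
qed

lemma transform_tube_prod:
  assumes "invertible (M :: 'f::field ^ 'n ^ 'n)"
  shows "M *v tvec (tube_prod M a b) = (\<chi> k. (M *v tvec a) $ k * (M *v tvec b) $ k)"
  by (simp add: tube_prod_def matrix_vector_mul_assoc matrix_mul_assoc matrix_inv_mul[OF assms]
      flip: diag_mult_vec)

lemma transform_inj:
  assumes "invertible (M :: 'f::field ^ 'n ^ 'n)" "M *v tvec a = M *v tvec b"
  shows "a = b"
proof -
  have "matrix_inv M *v (M *v tvec a) = matrix_inv M *v (M *v tvec b)"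
    using assms(2) by simp
  then have "tvec a = tvec b"
    by (simp add: matrix_vector_mul_assoc matrix_inv_mul[OF assms(1)])
  then show ?thesis by (metis tube_tvec)
qed

lemma tube_ring_cring:
  assumes M: "invertible (M :: 'f::field ^ 'n ^ 'n)"
  shows "cring (tube_ring M)"
proof (rule cringI)
  have "\<exists>y. y + x = 0" for x :: "('f, 'n) tube"
    by (rule exI[of _ "- x"]) simp
  then show "abelian_group (tube_ring M)"
    by (intro abelian_groupI) (auto simp: tube_ring_def add_ac)
  note simps = transform_tube_prod[OF M] vec_eq_iff tvec_add matrix_vector_right_distrib
    matrix_vector_mul_assoc matrix_inv_mul[OF M] distrib_right
  show "comm_monoid (tube_ring M)"
    by (rule comm_monoidI; simp add: tube_ring_def; rule transform_inj[OF M];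
        simp add: simps mult_ac)
  fix x y z
  show "(x \<oplus>\<^bsub>tube_ring M\<^esub> y) \<otimes>\<^bsub>tube_ring M\<^esub> z =
    x \<otimes>\<^bsub>tube_ring M\<^esub> z \<oplus>\<^bsub>tube_ring M\<^esub> y \<otimes>\<^bsub>tube_ring M\<^esub> z"
    by (simp add: tube_ring_def; rule transform_inj[OF M]; simp add: simps)
qed

definition mult_map :: "'f::field ^ 'n ^ 'n \<Rightarrow> ('f, 'n) tube \<Rightarrow> ('f, 'n) tube \<Rightarrow> ('f, 'n) tube" where
  "mult_map M a x = a \<otimes>\<^bsub>tube_ring M\<^esub> x"

definition tube_action ::
  "('g \<Rightarrow> 'f::field ^ 'n ^ 'n) \<Rightarrow> 'g \<Rightarrow> ('f, 'n) tube \<Rightarrow> ('f, 'n) tube" where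
  "tube_action \<rho> g x = tube (\<rho> g *v tvec x)"

definition equivariant ::
  "('g, 'b) monoid_scheme \<Rightarrow> ('g \<Rightarrow> 'f::field ^ 'n ^ 'n) \<Rightarrow>
   (('f, 'n) tube \<Rightarrow> ('f, 'n) tube) \<Rightarrow> bool" where
  "equivariant G \<rho> T \<longleftrightarrow>
     (\<forall>g \<in> carrier G. \<forall>x. T (tube_action \<rho> g x) = tube_action \<rho> g (T x))"

end

theory Submission
  imports Defs
begin

text \<open>In the coordinates \<open>M *v tvec x\<close>, multiplication by a tube is the entrywise product
  with an arbitrary vector and \<open>\<rho> g\<close> acts as \<open>D = M ** \<rho> g ** matrix_inv M\<close>. Equivariance of all
  multiplication maps therefore says that \<open>D\<close> commutes with every diagonal matrix, in particular with
  the matrix units \<open>diag (axis i 1)\<close>, which forces \<open>D\<close> to be diagonal.\<close>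

lemma is_diagonal_mult_vec:
  fixes D :: "'f::field ^ 'n ^ 'n"
  assumes "is_diagonal D"
  shows "(D *v y) $ i = D $ i $ i * y $ i"
proof -
  have "(D *v y) $ i = (\<Sum>j\<in>UNIV. D $ i $ j * y $ j)"
    by (simp add: matrix_vector_mult_def)
  also have "\<dots> = (\<Sum>j\<in>UNIV. if j = i then D $ i $ i * y $ i else 0)"
    using assms by (intro sum.cong) (auto simp: is_diagonal_def)
  finally show ?thesis by simp
qed

text \<open>Diagonal matrices act entrywise, so they commute because multiplication in the field
  does; conversely, testing on matrix units and basis vectors isolates each off-diagonal
  entry.\<close>

lemma is_diagonal_iff_commutes_diag:
  fixes D :: "'f::field ^ 'n ^ 'n"
  shows "is_diagonal D \<longleftrightarrow> (\<forall>u y. diag u *v (D *v y) = D *v (diag u *v y))"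
proof
  assume "is_diagonal D"
  then show "\<forall>u y. diag u *v (D *v y) = D *v (diag u *v y)"
    by (simp add: diag_mult_vec is_diagonal_mult_vec vec_eq_iff mult.left_commute)
next
  assume comm: "\<forall>u y. diag u *v (D *v y) = D *v (diag u *v y)"
  have "D $ i $ j = 0" if "i \<noteq> j" for i j
  proof -
    \<comment> \<open>Projecting first kills the \<open>j\<close>-th basis vector; projecting after
      \<open>D\<close> keeps entry \<open>i\<close> of column \<open>j\<close>, so commutation
      forces \<open>D $ i $ j\<close> to vanish.\<close>
    have "diag (axis i 1) *v axis j 1 = (0 :: 'f ^ 'n)"
      using that by (simp add: diag_mult_vec axis_def vec_eq_iff)
    then have "(diag (axis i 1) *v (D *v axis j 1)) $ i = 0"
      using comm by simp
    moreover have "(D *v axis j 1) $ i = D $ i $ j"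
      by (simp add: matrix_vector_mult_def axis_def if_distrib cong: if_cong)
    ultimately show ?thesis by (simp add: diag_mult_vec)
  qed
  then show "is_diagonal D" by (simp add: is_diagonal_def)
qed

lemma transform_tube_action:
  fixes M :: "'f::field ^ 'n ^ 'n"
  assumes "invertible M"
  shows "M *v tvec (tube_action \<rho> g x) = (M ** \<rho> g ** matrix_inv M) *v (M *v tvec x)"
proof -
  have "M ** \<rho> g ** matrix_inv M ** M = M ** \<rho> g"
    by (simp add: matrix_inv_mul[OF assms] flip: matrix_mul_assoc)
  then show ?thesis
    by (simp add: tube_action_def matrix_vector_mul_assoc)
qed

lemma transform_mult_map:
  fixes M :: "'f::field ^ 'n ^ 'n"
  assumes "invertible M"
  shows "M *v tvec (mult_map M a x) = diag (M *v tvec a) *v (M *v tvec x)"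
  by (simp add: mult_map_def tube_ring_def transform_tube_prod[OF assms] diag_mult_vec)

text \<open>Lets quantifiers over tubes become quantifiers over all vectors.\<close>

lemma surj_transform:
  fixes M :: "'f::field ^ 'n ^ 'n"
  assumes "invertible M"
  shows "surj (\<lambda>a. M *v tvec a)"
  by (rule surjI[of _ "\<lambda>u. tube (matrix_inv M *v u)"])
    (simp add: matrix_vector_mul_assoc matrix_inv_mul[OF assms])

lemma mult_maps_equivariant_iff_diagonal:
  fixes M :: "'f::field ^ 'n ^ 'n"
  assumes M: "invertible M"
  shows "(\<forall>a. equivariant G \<rho> (mult_map M a)) \<longleftrightarrow>
    (\<forall>g \<in> carrier G. is_diagonal (M ** \<rho> g ** matrix_inv M))"
proof -
  let ?D = "\<lambda>g. M ** \<rho> g ** matrix_inv M" and ?t = "\<lambda>x. M *v tvec x"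
  have "mult_map M a (tube_action \<rho> g x) = tube_action \<rho> g (mult_map M a x) \<longleftrightarrow>
      diag (?t a) *v (?D g *v ?t x) = ?D g *v (diag (?t a) *v ?t x)" for a g x
    \<comment> \<open>Folded back, the vector equation is the tube equation under
      \<open>M *v tvec _\<close>, which is injective.\<close>
    unfolding transform_mult_map[OF M, symmetric] transform_tube_action[OF M, symmetric]
    by (auto dest: transform_inj[OF M])
  then have "(\<forall>a. equivariant G \<rho> (mult_map M a)) \<longleftrightarrow>
      (\<forall>g \<in> carrier G. \<forall>u \<in> range ?t. \<forall>y \<in> range ?t. diag u *v (?D g *v y) = ?D g *v (diag u *v y))"
    unfolding equivariant_def by auto
  then show ?thesis
    by (simp add: surj_transform[OF M] is_diagonal_iff_commutes_diag)
qed

theorem theorem4p3: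
  fixes G :: "('g, 'b) monoid_scheme"
  assumes "group G" and "finite (carrier G)"
  shows
    "(\<forall>(\<rho> :: 'g \<Rightarrow> real ^ 'n ^ 'n) M.
        \<rho> \<in> hom G GL \<longrightarrow> M \<in> carrier GL \<longrightarrow>
        ((\<forall>a \<in> carrier (tube_ring M). equivariant G \<rho> (mult_map M a)) \<longleftrightarrow>
         (\<forall>g \<in> carrier G. is_diagonal (M ** \<rho> g ** matrix_inv M)))) \<and>
     (\<forall>(\<rho> :: 'g \<Rightarrow> complex ^ 'n ^ 'n) M.
        \<rho> \<in> hom G GL \<longrightarrow> M \<in> carrier GL \<longrightarrow>
        ((\<forall>a \<in> carrier (tube_ring M). equivariant G \<rho> (mult_map M a)) \<longleftrightarrow>
         (\<forall>g \<in> carrier G. is_diagonal (M ** \<rho> g ** matrix_inv M))))"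
  \<comment> \<open>Both conjuncts are instances of the equivalence over a general field:
    \<open>carrier GL\<close> consists of the invertible matrices, and every tube lies in
    \<open>carrier (tube_ring M)\<close>.\<close>
  by (simp add: mult_maps_equivariant_iff_diagonal tube_ring_def GL_def)

end
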